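(* Let $G_1$ and $G_2$ be two connected graphs. Then $$\max\{D(G_1),D(G_2)\}\leq D(G_1+G_2)\leq D(G_1)+D(G_2).$$
   Context: All graphs are finite and simple. For graphs $G_1=(V_1,E_1)$ and $G_2=(V_2,E_2)$ on disjoint vertex sets, the join $G_1+G_2$ is the graph with vertex set $V_1\cup V_2$ and edge set $E_1\cup E_2\cup\{uv: u\in V_1, v\in V_2\}$. A labeling $\phi:V(G)\to\{1,\ldots,r\}$ is $r$-distinguishing if the only automorphism $\sigma$ of $G$ with $\phi(\sigma(x))=\phi(x)$ for all $x\in V(G)$ is the identity. The distinguishing number $D(G)$ is the least $r$ such that $G$ has an $r$-distinguishing labeling. *)

theory Defs
  imports "Graph_Theory.Graph_Theory" "HOL-Combinatorics.Permutations"
begin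

text \<open>
  Finite simple graphs are the library's symmetric, loop-free, finite pair digraphs
  (\<^locale>\<open>pair_graph\<close>): an edge \<open>uv\<close> is represented by both pairs \<open>(u, v)\<close> and \<open>(v, u)\<close>.
  Connectedness is the library's \<^const>\<open>Digraph_Component.connected\<close>, which includes
  that the vertex set is nonempty.
\<close>

definition graph_join :: "'a pair_pre_digraph \<Rightarrow> 'a pair_pre_digraph \<Rightarrow> 'a pair_pre_digraph" where
  "graph_join G H =
    \<lparr> pverts = pverts G \<union> pverts H,
      parcs = parcs G \<union> parcs H \<union> pverts G \<times> pverts H \<union> pverts H \<times> pverts G \<rparr>"

text \<open>Automorphisms are extended by the identity outside the vertex set.\<close>

definition graph_automorphism :: "'a pair_pre_digraph \<Rightarrow> ('a \<Rightarrow> 'a) \<Rightarrow> bool" where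
  "graph_automorphism G \<sigma> \<longleftrightarrow>
    \<sigma> permutes pverts G \<and>
    (\<forall>u\<in>pverts G. \<forall>v\<in>pverts G. (\<sigma> u, \<sigma> v) \<in> parcs G \<longleftrightarrow> (u, v) \<in> parcs G)"

definition distinguishing_labeling :: "'a pair_pre_digraph \<Rightarrow> nat \<Rightarrow> ('a \<Rightarrow> nat) \<Rightarrow> bool" where
  "distinguishing_labeling G r \<phi> \<longleftrightarrow>
    (\<forall>x\<in>pverts G. \<phi> x \<in> {1..r}) \<and>
    (\<forall>\<sigma>. graph_automorphism G \<sigma> \<and> (\<forall>x\<in>pverts G. \<phi> (\<sigma> x) = \<phi> x) \<longrightarrow> \<sigma> = id)"

definition distinguishing_number :: "'a pair_pre_digraph \<Rightarrow> nat" where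
  "distinguishing_number G = (LEAST r. \<exists>\<phi>. distinguishing_labeling G r \<phi>)"

lemma ex_distinguishing_labeling:
  assumes "finite (pverts G)"
  shows "\<exists>r \<phi>. distinguishing_labeling G r \<phi>"
proof -
  obtain f where f: "bij_betw f (pverts G) {1..card (pverts G)}"
    using ex_bij_betw_finite_nat[OF assms] finite_same_card_bij[OF assms, of "{1..card (pverts G)}"]
    by auto
  have "distinguishing_labeling G (card (pverts G)) f"
    unfolding distinguishing_labeling_def
  proof (intro conjI allI impI ballI)
    show "f x \<in> {1..card (pverts G)}" if "x \<in> pverts G" for x
      using f that by (auto simp: bij_betw_def)
  next
    fix \<sigma> assume "graph_automorphism G \<sigma> \<and> (\<forall>x\<in>pverts G. f (\<sigma> x) = f x)"
    then have p: "\<sigma> permutes pverts G" and e: "\<And>x. x \<in> pverts G \<Longrightarrow> f (\<sigma> x) = f x"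
      by (auto simp: graph_automorphism_def)
    show "\<sigma> = id"
    proof
      fix x show "\<sigma> x = id x"
      proof (cases "x \<in> pverts G")
        case True
        then have "\<sigma> x \<in> pverts G" using p by (simp add: permutes_in_image)
        then show ?thesis using e[OF True] True f by (auto simp: bij_betw_def dest: inj_onD)
      next
        case False
        then show ?thesis using p by (simp add: permutes_not_in)
      qed
    qed
  qed
  then show ?thesis by blast
qed

lemma pair_graph_graph_join:
  assumes "pair_graph G" "pair_graph H" "pverts G \<inter> pverts H = {}"
  shows "pair_graph (graph_join G H)"
proof -
  interpret G: pair_graph G by fact
  interpret H: pair_graph H by fact
  have "sym (parcs G)" "sym (parcs H)"
    using G.pair_sym_arcs H.pair_sym_arcs by (simp_all add: symmetric_def)
  then have s: "sym (parcs (graph_join G H))"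
    by (auto simp: graph_join_def sym_def)
  show ?thesis
  proof
    show "finite (pverts (graph_join G H))" "finite (parcs (graph_join G H))"
      using G.pair_finite_verts H.pair_finite_verts G.pair_finite_arcs H.pair_finite_arcs
      by (auto simp: graph_join_def)
    show "symmetric (with_proj (graph_join G H))"
      using s by (simp add: symmetric_def)
    fix e assume e: "e \<in> parcs (graph_join G H)"
    show "fst e \<in> pverts (graph_join G H)" "snd e \<in> pverts (graph_join G H)"
      using e G.arc_fst_in_verts H.arc_fst_in_verts G.arc_snd_in_verts H.arc_snd_in_verts
      by (auto simp: graph_join_def)
    show "fst e \<noteq> snd e"
      using e G.pair_no_loops H.pair_no_loops assms(3) by (fastforce simp: graph_join_def)
  qed
qed

end

theory Submission
  imports Defs
begin

text \<open>
  An automorphism of one side, extended by the identity, is an automorphism of the join, so a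
  distinguishing labeling of the join restricts to one of each side. Conversely, label the two
  sides with disjoint sets of colours: an automorphism of the join that preserves the colours then
  preserves each side and induces there a colour-preserving automorphism.
\<close>

text \<open>Lets the facts about the left side of a join serve for the right side as well.\<close>

lemma graph_join_commute: "graph_join G H = graph_join H G"
  by (auto simp: graph_join_def)

text \<open>Any arc that the join adds to those of \<open>G\<close> has an endpoint in
  \<open>H\<close>, so by disjointness it cannot link two vertices of \<open>G\<close>.\<close>

lemma parcs_graph_join_iff:
  assumes "pair_graph G" "pair_graph H" "pverts G \<inter> pverts H = {}"
    and "u \<in> pverts G" "v \<in> pverts G"
  shows "(u, v) \<in> parcs (graph_join G H) \<longleftrightarrow> (u, v) \<in> parcs G"
proof -
  interpret H: pair_graph H by fact
  have "u \<notin> pverts H" "v \<notin> pverts H"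
    using assms by auto
  then show ?thesis
    using H.arc_fst_in_verts[of "(u, v)"] by (auto simp: graph_join_def)
qed

text \<open>Every vertex of \<open>G\<close> is joined to every vertex of \<open>H\<close>, so
  permuting \<open>G\<close> alone cannot break a cross adjacency. Since \<open>permutes\<close>
  already makes \<sigma> the identity off \<open>G\<close>, the same function serves as its own
  extension.\<close>

lemma graph_automorphism_joinI:
  assumes G: "pair_graph G" and H: "pair_graph H" and disj: "pverts G \<inter> pverts H = {}"
    and \<sigma>: "graph_automorphism G \<sigma>"
  shows "graph_automorphism (graph_join G H) \<sigma>"
proof -
  have p: "\<sigma> permutes pverts G"
    and e: "\<And>u v. u \<in> pverts G \<Longrightarrow> v \<in> pverts G \<Longrightarrow> (\<sigma> u, \<sigma> v) \<in> parcs G \<longleftrightarrow> (u, v) \<in> parcs G"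
    using \<sigma> by (auto simp: graph_automorphism_def)
  have in_G: "\<sigma> u \<in> pverts G \<longleftrightarrow> u \<in> pverts G" for u
    using p by (rule permutes_in_image)
  have fix_H: "\<sigma> u = u" if "u \<in> pverts H" for u
    using that disj p by (auto intro: permutes_not_in)
  have "(\<sigma> u, \<sigma> v) \<in> parcs (graph_join G H) \<longleftrightarrow> (u, v) \<in> parcs (graph_join G H)"
    if uv: "u \<in> pverts G \<union> pverts H" "v \<in> pverts G \<union> pverts H" for u v
  proof (cases "u \<in> pverts G")
    case u: True
    show ?thesis
    proof (cases "v \<in> pverts G")
      case True
      with u show ?thesis
        by (simp add: parcs_graph_join_iff[OF G H disj] in_G e)
    next
      case False
      with uv u show ?thesis
        by (simp add: graph_join_def in_G fix_H)
    qed
  next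
    case u: False
    show ?thesis
    proof (cases "v \<in> pverts G")
      case True
      with uv u show ?thesis
        by (simp add: graph_join_def in_G fix_H)
    next
      case False
      with uv u show ?thesis
        by (simp add: fix_H)
    qed
  qed
  moreover have "\<sigma> permutes pverts (graph_join G H)"
    using p by (rule permutes_subset) (simp add: graph_join_def)
  ultimately show ?thesis
    by (simp add: graph_automorphism_def graph_join_def)
qed

text \<open>The conditional resets \<sigma> to the identity off \<open>G\<close>, as
  \<open>permutes\<close> demands; \<sigma> itself may still move vertices of
  \<open>H\<close>.\<close>

lemma graph_automorphism_join_restrict:
  assumes G: "pair_graph G" and H: "pair_graph H" and disj: "pverts G \<inter> pverts H = {}"
    and \<sigma>: "graph_automorphism (graph_join G H) \<sigma>" and sub: "\<sigma> ` pverts G \<subseteq> pverts G"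
  shows "graph_automorphism G (\<lambda>x. if x \<in> pverts G then \<sigma> x else x)"
proof -
  interpret G: pair_graph G by fact
  have p: "\<sigma> permutes pverts (graph_join G H)"
    and e: "\<And>u v. u \<in> pverts G \<Longrightarrow> v \<in> pverts G \<Longrightarrow>
      (\<sigma> u, \<sigma> v) \<in> parcs (graph_join G H) \<longleftrightarrow> (u, v) \<in> parcs (graph_join G H)"
    using \<sigma> by (auto simp: graph_automorphism_def graph_join_def)
  have inj: "inj_on \<sigma> (pverts G)"
    using permutes_inj[OF p] by (rule inj_on_subset) simp
  \<comment> \<open>An injective self-map of a finite set is onto, so the inclusion
    \<open>sub\<close> is enough.\<close>
  have "bij_betw \<sigma> (pverts G) (pverts G)"
    using endo_inj_surj[OF G.pair_finite_verts sub inj] inj by (simp add: bij_betw_def)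
  then have "bij_betw (\<lambda>x. if x \<in> pverts G then \<sigma> x else x) (pverts G) (pverts G)"
    by (simp cong: bij_betw_cong)
  then have "(\<lambda>x. if x \<in> pverts G then \<sigma> x else x) permutes pverts G"
    by (rule bij_imp_permutes) simp
  moreover have "(\<sigma> u, \<sigma> v) \<in> parcs G \<longleftrightarrow> (u, v) \<in> parcs G"
    if "u \<in> pverts G" "v \<in> pverts G" for u v
    using e[OF that] that sub by (simp add: parcs_graph_join_iff[OF G H disj] image_subset_iff)
  ultimately show ?thesis
    by (simp add: graph_automorphism_def)
qed

lemma distinguishing_labeling_join_left:
  assumes "pair_graph G" "pair_graph H" "pverts G \<inter> pverts H = {}"
    and \<phi>: "distinguishing_labeling (graph_join G H) r \<phi>"
  shows "distinguishing_labeling G r \<phi>"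
  unfolding distinguishing_labeling_def
proof (intro conjI allI impI ballI)
  show "\<phi> x \<in> {1..r}" if "x \<in> pverts G" for x
    using \<phi> that by (simp add: distinguishing_labeling_def graph_join_def)
next
  fix \<sigma> assume \<sigma>: "graph_automorphism G \<sigma> \<and> (\<forall>x\<in>pverts G. \<phi> (\<sigma> x) = \<phi> x)"
  \<comment> \<open>Off \<open>G\<close> the map \<sigma> is the identity, so the labels on
    \<open>H\<close> are preserved too.\<close>
  then have "\<phi> (\<sigma> x) = \<phi> x" for x
    by (cases "x \<in> pverts G") (auto simp: graph_automorphism_def permutes_not_in)
  moreover have "graph_automorphism (graph_join G H) \<sigma>"
    using assms \<sigma> by (simp add: graph_automorphism_joinI)
  ultimately show "\<sigma> = id"
    using \<phi> by (simp add: distinguishing_labeling_def)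
qed

text \<open>Stated for one side so that it can be applied twice, the second time with
  \<open>G\<close> and \<open>H\<close> exchanged.\<close>

lemma distinguishing_labeling_fixes_side:
  assumes "pair_graph G" "pair_graph H" "pverts G \<inter> pverts H = {}"
    and f: "distinguishing_labeling G r f"
    and "graph_automorphism (graph_join G H) \<sigma>" "\<sigma> ` pverts G \<subseteq> pverts G"
    and "\<And>x. x \<in> pverts G \<Longrightarrow> f (\<sigma> x) = f x"
    and x: "x \<in> pverts G"
  shows "\<sigma> x = x"
proof -
  have "graph_automorphism G (\<lambda>x. if x \<in> pverts G then \<sigma> x else x)"
    using assms by (intro graph_automorphism_join_restrict)
  with f assms(7) have "(\<lambda>x. if x \<in> pverts G then \<sigma> x else x) = id"
    by (simp add: distinguishing_labeling_def)
  from fun_cong[OF this, of x] x show ?thesis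
    by simp
qed

text \<open>Shifting \<open>g\<close> by \<open>r\<close> moves the colours of \<open>H\<close> into
  r + 1, ..., r + s, away from those of \<open>G\<close>, so that a colour reveals the side of its
  vertex.\<close>

lemma distinguishing_labeling_join:
  assumes G: "pair_graph G" and H: "pair_graph H" and disj: "pverts G \<inter> pverts H = {}"
    and f: "distinguishing_labeling G r f" and g: "distinguishing_labeling H s g"
  shows "distinguishing_labeling (graph_join G H) (r + s)
    (\<lambda>x. if x \<in> pverts G then f x else r + g x)"
    (is "distinguishing_labeling _ _ ?h")
  unfolding distinguishing_labeling_def
proof (intro conjI allI impI ballI)
  have f_range: "1 \<le> f x \<and> f x \<le> r" if "x \<in> pverts G" for x
    using f that by (simp add: distinguishing_labeling_def)
  have g_range: "1 \<le> g x \<and> g x \<le> s" if "x \<in> pverts H" for x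
    using g that by (simp add: distinguishing_labeling_def)
  show "?h x \<in> {1..r + s}" if "x \<in> pverts (graph_join G H)" for x
    using that f_range[of x] g_range[of x] by (auto simp: graph_join_def)
  fix \<sigma> assume "graph_automorphism (graph_join G H) \<sigma> \<and>
    (\<forall>x\<in>pverts (graph_join G H). ?h (\<sigma> x) = ?h x)"
  then have \<sigma>: "graph_automorphism (graph_join G H) \<sigma>"
    and h: "\<And>x. x \<in> pverts G \<union> pverts H \<Longrightarrow> ?h (\<sigma> x) = ?h x"
    by (simp_all add: graph_join_def)
  have p: "\<sigma> permutes pverts G \<union> pverts H"
    using \<sigma> by (simp add: graph_automorphism_def graph_join_def)
  \<comment> \<open>The threshold is sharp because labels start at 1: on \<open>H\<close> the value
    \<open>r + g x\<close> exceeds \<open>r\<close>.\<close>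
  have h_le_iff: "?h x \<le> r \<longleftrightarrow> x \<in> pverts G" if "x \<in> pverts G \<union> pverts H" for x
    using that f_range[of x] g_range[of x] by auto
  have closed: "\<sigma> x \<in> pverts G \<union> pverts H" if "x \<in> pverts G \<union> pverts H" for x
    using p that by (simp only: permutes_in_image)
  \<comment> \<open>The vertices \<open>x\<close> and \<open>\<sigma> x\<close> have the same
    colour, hence lie on the same side of the threshold; \<open>closed\<close> is what allows
    \<open>h_le_iff\<close> at \<open>\<sigma> x\<close>.\<close>
  have side: "\<sigma> x \<in> pverts G \<longleftrightarrow> x \<in> pverts G" if "x \<in> pverts G \<union> pverts H" for x
    using h_le_iff[OF that] h_le_iff[OF closed[OF that]] h[OF that] by simp
  have fix_G: "\<sigma> x = x" if "x \<in> pverts G" for x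
  proof (rule distinguishing_labeling_fixes_side[OF G H disj f \<sigma> _ _ that])
    show "\<sigma> ` pverts G \<subseteq> pverts G"
      using side by blast
    show "f (\<sigma> y) = f y" if "y \<in> pverts G" for y
      using h[of y] side[of y] that by simp
  qed
  have fix_H: "\<sigma> x = x" if "x \<in> pverts H" for x
  proof (rule distinguishing_labeling_fixes_side[OF H G _ g _ _ _ that])
    show "pverts H \<inter> pverts G = {}"
      using disj by blast
    show "graph_automorphism (graph_join H G) \<sigma>"
      using \<sigma> by (simp add: graph_join_commute)
    \<comment> \<open>Here \<open>side\<close> only keeps the image out of \<open>G\<close>;
      \<open>closed\<close> then places it in \<open>H\<close>.\<close>
    show "\<sigma> ` pverts H \<subseteq> pverts H"
      using side closed disj by blast
    show "g (\<sigma> y) = g y" if "y \<in> pverts H" for y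
    proof -
      have "y \<notin> pverts G"
        using that disj by blast
      then show ?thesis
        using h[of y] side[of y] that by simp
    qed
  qed
  show "\<sigma> = id"
  proof
    show "\<sigma> x = id x" for x
      using fix_G fix_H permutes_not_in[OF p, of x] by (cases "x \<in> pverts G \<union> pverts H") auto
  qed
qed

lemma distinguishing_number_le:
  "distinguishing_labeling G r \<phi> \<Longrightarrow> distinguishing_number G \<le> r"
  unfolding distinguishing_number_def by (rule Least_le) blast

text \<open>The \<open>LEAST\<close> is attained because some distinguishing labeling exists:
  numbering the finitely many vertices injectively leaves only the identity.\<close>

lemma ex_labeling_distinguishing_number:
  assumes "pair_graph G"
  shows "\<exists>\<phi>. distinguishing_labeling G (distinguishing_number G) \<phi>"
proof -
  interpret pair_graph G by fact
  show ?thesis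
    unfolding distinguishing_number_def
    by (rule LeastI_ex) (rule ex_distinguishing_labeling[OF pair_finite_verts])
qed

text \<open>An optimal labeling of the join, restricted to \<open>G\<close>, is distinguishing with
  the same number of colours.\<close>

lemma distinguishing_number_le_join:
  assumes "pair_graph G" "pair_graph H" "pverts G \<inter> pverts H = {}"
  shows "distinguishing_number G \<le> distinguishing_number (graph_join G H)"
proof -
  obtain \<phi> where
    "distinguishing_labeling (graph_join G H) (distinguishing_number (graph_join G H)) \<phi>"
    using ex_labeling_distinguishing_number[OF pair_graph_graph_join[OF assms]] by blast
  then show ?thesis
    by (intro distinguishing_number_le) (rule distinguishing_labeling_join_left[OF assms])
qed

theorem theorem2p1:
  fixes G1 G2 :: "'a pair_pre_digraph"
  assumes "pair_graph G1" and "pair_graph G2"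
    and "pverts G1 \<inter> pverts G2 = {}"
    and "Digraph_Component.connected (with_proj G1)"
    and "Digraph_Component.connected (with_proj G2)"
  shows "max (distinguishing_number G1) (distinguishing_number G2)
           \<le> distinguishing_number (graph_join G1 G2) \<and>
         distinguishing_number (graph_join G1 G2)
           \<le> distinguishing_number G1 + distinguishing_number G2"
proof -
  obtain f g where "distinguishing_labeling G1 (distinguishing_number G1) f"
    and "distinguishing_labeling G2 (distinguishing_number G2) g"
    using ex_labeling_distinguishing_number assms(1,2) by blast
  then have "distinguishing_number (graph_join G1 G2)
      \<le> distinguishing_number G1 + distinguishing_number G2"
    by (intro distinguishing_number_le) (rule distinguishing_labeling_join[OF assms(1-3)])
  moreover have "distinguishing_number G1 \<le> distinguishing_number (graph_join G1 G2)"
    by (rule distinguishing_number_le_join[OF assms(1-3)])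
  moreover have "distinguishing_number G2 \<le> distinguishing_number (graph_join G1 G2)"
    using distinguishing_number_le_join[OF assms(2,1)] assms(3)
    by (simp add: graph_join_commute[of G1] Int_commute)
  ultimately show ?thesis
    by simp
qed

end
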